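(* Let $K$ be a field and let $I\subset K[x,y]$ be a monomial ideal generated in degree $d$ with $\mu(I)=m$ and $\operatorname{height} I=2$. Let $J=(x^d,y^d)$. Then the following conditions are equivalent: (i) $\mu(I^k)=k(m-1)+1$ for some $k\geq 2$; (ii) $I^2=JI$.
   Context: $\mu(L)$ denotes the minimal number of generators of a monomial ideal $L$. "Generated in degree $d$" means that all minimal monomial generators of $I$ have degree $d$. *)

theory Defs
  imports
    "HOL-Algebra.Algebraic_Closure_Type"
    "HOL-Algebra.Ideal_Product"
    "HOL-Library.Poly_Mapping"
    "HOL-Library.Product_Plus"
    "HOL-Library.Extended_Nat"
begin

section \<open>Generators and height of ideals in a commutative ring\<close>

text \<open>For an ideal that is not finitely generated the value is unspecified; this does not
  occur in the Noetherian ring considered below.\<close>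

definition min_num_gens :: "('a, 'b) ring_scheme \<Rightarrow> 'a set \<Rightarrow> nat" where
  "min_num_gens R I =
     (LEAST n. \<exists>S. S \<subseteq> carrier R \<and> finite S \<and> card S = n \<and> I = Idl\<^bsub>R\<^esub> S)"

definition prime_height :: "('a, 'b) ring_scheme \<Rightarrow> 'a set \<Rightarrow> enat" where
  "prime_height R P =
     Sup {enat n | n. \<exists>C :: nat \<Rightarrow> 'a set.
       (\<forall>i\<le>n. primeideal (C i) R) \<and> (\<forall>i<n. C i \<subset> C (Suc i)) \<and> C n = P}"

text \<open>The infimum of the empty set in \<^typ>\<open>enat\<close> is \<open>\<infinity>\<close>, so the unit ideal has
  height \<open>\<infinity>\<close>.\<close>

definition ideal_height :: "('a, 'b) ring_scheme \<Rightarrow> 'a set \<Rightarrow> enat" where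
  "ideal_height R I = Inf {prime_height R P | P. primeideal P R \<and> I \<subseteq> P}"


section \<open>Monomial ideals in two variables\<close>

text \<open>The polynomial ring \<open>K[x,y]\<close> is the monoid algebra of \<open>\<nat> \<times> \<nat>\<close> over \<open>K\<close>: a polynomial
  is a finitely supported map sending the exponent pair \<open>(a, b)\<close> to the coefficient of
  \<open>x\<^sup>a y\<^sup>b\<close>, and multiplication is convolution.\<close>

type_synonym 'k poly2 = "(nat \<times> nat) \<Rightarrow>\<^sub>0 'k"

abbreviation Kxy :: "'k::field poly2 ring" where
  "Kxy \<equiv> ring_of_type_algebra"

definition xy_monomial :: "nat \<Rightarrow> nat \<Rightarrow> 'k::field poly2" where
  "xy_monomial a b = Poly_Mapping.single (a, b) 1"

definition var_x :: "'k::field poly2" where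
  "var_x = xy_monomial 1 0"

definition var_y :: "'k::field poly2" where
  "var_y = xy_monomial 0 1"

lemma xy_monomial_eq: "(xy_monomial a b :: 'k::field poly2) = var_x ^ a * var_y ^ b"
proof -
  have mult: "xy_monomial a b * xy_monomial c d = (xy_monomial (a + c) (b + d) :: 'k poly2)"
    for a b c d
    by (simp add: xy_monomial_def Poly_Mapping.mult_single)
  have one: "xy_monomial 0 0 = (1 :: 'k poly2)"
    by (simp add: xy_monomial_def flip: zero_prod_def)
  have x: "var_x ^ n = (xy_monomial n 0 :: 'k poly2)" for n
    by (induction n) (simp_all add: one mult var_x_def)
  have y: "var_y ^ n = (xy_monomial 0 n :: 'k poly2)" for n
    by (induction n) (simp_all add: one mult var_y_def)
  show ?thesis
    by (simp add: x y mult)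
qed

definition monomials :: "'k::field poly2 set" where
  "monomials = {xy_monomial a b | a b. True}"

definition monomial_ideal :: "'k::field poly2 set \<Rightarrow> bool" where
  "monomial_ideal I \<longleftrightarrow> (\<exists>M \<subseteq> monomials. I = Idl\<^bsub>Kxy\<^esub> M)"

text \<open>The unique minimal set of monomial generators of a monomial ideal consists of the
  monomials in it that are minimal with respect to divisibility.\<close>

definition min_monomial_gens :: "'k::field poly2 set \<Rightarrow> 'k poly2 set" where
  "min_monomial_gens I =
     {u \<in> monomials \<inter> I. \<forall>v \<in> monomials \<inter> I. v dvd u \<longrightarrow> v = u}"

definition generated_in_degree :: "'k::field poly2 set \<Rightarrow> nat \<Rightarrow> bool" where
  "generated_in_degree I d \<longleftrightarrow>
     (\<forall>a b. xy_monomial a b \<in> min_monomial_gens I \<longrightarrow> a + b = d)"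

end

theory Submission
  imports Defs "HOL-Library.Set_Algebras"
begin

text \<open>
  Write \<open>I = (x\<^sup>a y\<^sup>d\<^sup>-\<^sup>a | a \<in> A)\<close> with \<open>A \<subseteq> {0, \<dots>, d}\<close>. All statements about \<open>I\<close> become
  statements about sumsets of \<open>A\<close>. Multiplying ideals adds exponents, so \<open>I\<^sup>k\<close> corresponds to
  the \<open>k\<close>-fold sumset \<open>kA\<close> in degree \<open>kd\<close> (\<open>mon_ideal_prod\<close>, \<open>mon_ideal_pow\<close>). Distinct monomials
  of the same degree do not divide each other, so they form a minimal generating set, and no
  generating set, monomial or not, is smaller (\<open>min_num_gens_mon_ideal\<close>); hence \<open>\<mu>(I\<^sup>k) = |kA|\<close>
  and \<open>m = |A|\<close>. Height 2 implies that \<open>I\<close> is contained neither in \<open>(x)\<close> nor in \<open>(y)\<close>, because these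
  primes have height at most 1; so \<open>x\<^sup>d\<close> and \<open>y\<^sup>d\<close> lie in \<open>I\<close>, that is, \<open>0, d \<in> A\<close>
  (\<open>pure_powers_if_height_2\<close>). Finally \<open>J\<close> corresponds to \<open>{0, d}\<close>.

  What remains is a fact about sets of integers (\<open>card_iterated_sumset_eq_iff\<close>):
  \<open>|kA| = k(m - 1) + 1\<close> for some \<open>k \<ge> 2\<close> if and only if \<open>2A = {0, d} + A\<close>. The right-hand set is
  contained in \<open>2A\<close> and has exactly \<open>2m - 1\<close> elements, since \<open>A\<close> and \<open>d + A\<close> meet only in \<open>d\<close>. The
  condition \<open>2A = {0, d} + A\<close> is therefore the case \<open>k = 2\<close> of the cardinality condition. Larger
  \<open>k\<close> reduce to \<open>k = 2\<close>: each further summand \<open>A\<close> increases the cardinality of a sumset by at least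
  \<open>m - 1\<close>, so \<open>|kA| = k(m - 1) + 1\<close> forces \<open>|2A| \<le> 2m - 1\<close>.
\<close>

section \<open>Monomial ideals and their exponents\<close>

text \<open>The set \<open>E + UNIV\<close> consists of the exponents of all multiples of the monomials with
  exponent in \<open>E\<close>. Describing the ideal by exponents instead of by generators makes membership
  a condition on the individual terms; \<open>genideal_monomials\<close> is the link to generated ideals.\<close>

definition mon_ideal :: "'e::comm_monoid_add set \<Rightarrow> ('e \<Rightarrow>\<^sub>0 'k::comm_ring_1) set" where
  "mon_ideal E = {f. Poly_Mapping.keys f \<subseteq> E + UNIV}"

lemma mem_upset_iff: "p \<in> E + UNIV \<longleftrightarrow> (\<exists>e\<in>E. \<exists>s. p = e + s)"
  by (auto simp: set_plus_def)

lemma ring_of_type_algebra_simps [simp]: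
  "carrier (ring_of_type_algebra :: 'a::comm_ring_1 ring) = UNIV"
  "x \<otimes>\<^bsub>ring_of_type_algebra\<^esub> y = x * (y :: 'a)"
  "x \<oplus>\<^bsub>ring_of_type_algebra\<^esub> y = x + (y :: 'a)"
  "\<zero>\<^bsub>ring_of_type_algebra\<^esub> = (0 :: 'a)"
  "\<one>\<^bsub>ring_of_type_algebra\<^esub> = (1 :: 'a)"
  by (simp_all add: ring_of_type_algebra_def)

lemma ideal_of_type_algebra_iff:
  "ideal I (ring_of_type_algebra :: 'a::comm_ring_1 ring) \<longleftrightarrow>
     0 \<in> I \<and> (\<forall>a\<in>I. \<forall>b\<in>I. a + b \<in> I) \<and> (\<forall>r. \<forall>a\<in>I. r * a \<in> I)"
    (is "?L \<longleftrightarrow> ?R")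
proof
  assume ?L
  then interpret ideal I "ring_of_type_algebra :: 'a ring" .
  show ?R
    using zero_closed additive_subgroup.zero_closed[OF is_additive_subgroup]
      additive_subgroup.a_closed[OF is_additive_subgroup] I_l_closed by auto
next
  assume R: ?R
  interpret cring "ring_of_type_algebra :: 'a ring" ..
  have inv: "\<ominus>\<^bsub>ring_of_type_algebra\<^esub> a = - a" for a :: 'a
    by (rule minus_equality) simp_all
  have neg: "- a \<in> I" if "a \<in> I" for a
    using R that by (metis mult_minus1)
  show ?L
  proof (rule idealI)
    show "ring (ring_of_type_algebra :: 'a ring)" ..
    show "subgroup I (add_monoid (ring_of_type_algebra :: 'a ring))"
      using R neg inv by unfold_locales (auto simp: a_inv_def)
  qed (use R in \<open>simp_all, metis mult.commute\<close>)
qed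

lemma ideal_mon_ideal:
  "ideal (mon_ideal E) (ring_of_type_algebra :: ('e::comm_monoid_add \<Rightarrow>\<^sub>0 'k::comm_ring_1) ring)"
proof -
  have "r * f \<in> mon_ideal E" if "f \<in> mon_ideal E" for r f :: "'e \<Rightarrow>\<^sub>0 'k"
  proof -
    have "p + q \<in> E + UNIV" if "q \<in> E + UNIV" for p q :: 'e
      using that unfolding mem_upset_iff by (metis add.left_commute)
    then show ?thesis
      using that keys_mult[of r f] unfolding mon_ideal_def by blast
  qed
  moreover have "f + g \<in> mon_ideal E" if "f \<in> mon_ideal E" "g \<in> mon_ideal E"
    for f g :: "'e \<Rightarrow>\<^sub>0 'k"
    using that keys_add[of f g] unfolding mon_ideal_def by blast
  moreover have "(0 :: 'e \<Rightarrow>\<^sub>0 'k) \<in> mon_ideal E"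
    by (simp add: mon_ideal_def)
  ultimately show ?thesis
    unfolding ideal_of_type_algebra_iff by blast
qed

lemma single_in_mon_ideal_iff:
  "Poly_Mapping.single p (1::'k::comm_ring_1) \<in> mon_ideal E \<longleftrightarrow> p \<in> E + UNIV"
  by (simp add: mon_ideal_def)

lemma sum_single_lookup:
  "(\<Sum>p\<in>Poly_Mapping.keys f. Poly_Mapping.single p (Poly_Mapping.lookup f p)) = f"
  by (rule poly_mapping_eqI)
     (auto simp: lookup_sum lookup_single when_def in_keys_iff sum.delta)

lemma genideal_monomials:
  "Idl\<^bsub>ring_of_type_algebra\<^esub> ((\<lambda>p. Poly_Mapping.single p 1) ` E) =
     (mon_ideal E :: ('e::comm_monoid_add \<Rightarrow>\<^sub>0 'k::comm_ring_1) set)"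
    (is "Idl\<^bsub>?R\<^esub> ?S = _")
proof
  interpret cring ?R ..
  have "p \<in> E + UNIV" if "p \<in> E" for p
    using that unfolding mem_upset_iff by (metis add.right_neutral)
  then show "Idl\<^bsub>?R\<^esub> ?S \<subseteq> mon_ideal E"
    by (intro genideal_minimal[OF ideal_mon_ideal]) (auto simp: single_in_mon_ideal_iff)
  have I: "ideal (Idl\<^bsub>?R\<^esub> ?S) ?R"
    by (rule genideal_ideal) simp
  have sum: "sum g A \<in> Idl\<^bsub>?R\<^esub> ?S" if "\<And>p. p \<in> A \<Longrightarrow> g p \<in> Idl\<^bsub>?R\<^esub> ?S" for g and A :: "'e set"
    using that I by (induction A rule: infinite_finite_induct) (auto simp: ideal_of_type_algebra_iff)
  have single: "Poly_Mapping.single p c \<in> Idl\<^bsub>?R\<^esub> ?S" if p: "p \<in> E + UNIV" for p c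
  proof -
    obtain e s where "p = e + s" "e \<in> E"
      using p unfolding mem_upset_iff by blast
    then have "Poly_Mapping.single p c = Poly_Mapping.single s c * Poly_Mapping.single e 1"
      by (simp add: mult_single add.commute)
    moreover have "Poly_Mapping.single e 1 \<in> Idl\<^bsub>?R\<^esub> ?S"
      using genideal_self[of ?S] \<open>e \<in> E\<close> by auto
    ultimately show ?thesis
      using I by (simp add: ideal_of_type_algebra_iff)
  qed
  show "mon_ideal E \<subseteq> Idl\<^bsub>?R\<^esub> ?S"
  proof
    fix f :: "'e \<Rightarrow>\<^sub>0 'k" assume "f \<in> mon_ideal E"
    then have "(\<Sum>p\<in>Poly_Mapping.keys f. Poly_Mapping.single p (Poly_Mapping.lookup f p)) \<in> Idl\<^bsub>?R\<^esub> ?S"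
      by (intro sum single) (auto simp: mon_ideal_def)
    then show "f \<in> Idl\<^bsub>?R\<^esub> ?S"
      by (simp only: sum_single_lookup)
  qed
qed

lemma mon_ideal_prod:
  "mon_ideal E \<cdot>\<^bsub>ring_of_type_algebra\<^esub> mon_ideal F =
     (mon_ideal (E + F) :: ('e::comm_monoid_add \<Rightarrow>\<^sub>0 'k::comm_ring_1) set)"
    (is "?P = _")
proof
  interpret cring "ring_of_type_algebra :: ('e \<Rightarrow>\<^sub>0 'k) ring" ..
  have gen: "Poly_Mapping.single p (1::'k) \<in> mon_ideal G" if "p \<in> G" for p :: 'e and G
    using that unfolding single_in_mon_ideal_iff mem_upset_iff by (metis add.right_neutral)
  have sums: "p + q \<in> (E + F) + UNIV" if pq: "p \<in> E + UNIV" "q \<in> F + UNIV" for p q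
  proof -
    obtain e s f t where "p = e + s" "q = f + t" "e \<in> E" "f \<in> F"
      using pq unfolding mem_upset_iff by blast
    then have "p + q = (e + f) + (s + t)"
      by (simp add: add.assoc add.left_commute)
    moreover have "e + f \<in> E + F"
      using \<open>e \<in> E\<close> \<open>f \<in> F\<close> by (rule set_plus_intro)
    ultimately show ?thesis
      unfolding mem_upset_iff by blast
  qed
  show "?P \<subseteq> mon_ideal (E + F)"
  proof
    fix h assume "h \<in> ?P"
    then show "h \<in> mon_ideal (E + F)"
    proof induction
      case (prod f g)
      then show ?case
        using keys_mult[of f g] sums unfolding mon_ideal_def by simp blast
    next
      case (sum f g)
      then show ?case
        using ideal_mon_ideal[of "E + F"] unfolding ideal_of_type_algebra_iff
          ring_of_type_algebra_simps by blast
    qed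
  qed
  have "Poly_Mapping.single (e + f) 1 \<in> ?P" if "e \<in> E" "f \<in> F" for e f
    using ideal_prod.prod[OF gen[OF that(1)] gen[OF that(2)], of ring_of_type_algebra]
    by (simp add: mult_single)
  then show "mon_ideal (E + F) \<subseteq> ?P"
    unfolding genideal_monomials[symmetric]
    by (intro genideal_minimal ideal_prod_is_ideal genideal_ideal)
       (auto elim!: set_plus_elim simp: genideal_monomials)
qed

lemma mon_ideal_pow:
  "mon_ideal E [^]\<^bsub>ideals_set ring_of_type_algebra\<^esub> (k::nat) =
     (mon_ideal (\<Sum>i<k. E) :: ('e::comm_monoid_add \<Rightarrow>\<^sub>0 'k::comm_ring_1) set)"
proof -
  interpret cring "ring_of_type_algebra :: ('e \<Rightarrow>\<^sub>0 'k) ring" ..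
  interpret ideals: comm_monoid "ideals_set (ring_of_type_algebra :: ('e \<Rightarrow>\<^sub>0 'k) ring)"
    by (rule ideals_set_is_comm_monoid)
  show ?thesis
  proof (induction k)
    case 0
    have "(UNIV :: 'e set) = {0} + UNIV"
      by (auto simp: set_plus_def)
    then have "mon_ideal {0} = (UNIV :: ('e \<Rightarrow>\<^sub>0 'k) set)"
      by (simp add: mon_ideal_def)
    then show ?case
      by (simp add: ideals_set_def set_zero)
  next
    case (Suc k)
    then have "mon_ideal E [^]\<^bsub>ideals_set ring_of_type_algebra\<^esub> Suc k =
      (mon_ideal (\<Sum>i<k. E) \<cdot>\<^bsub>ring_of_type_algebra\<^esub> mon_ideal E :: ('e \<Rightarrow>\<^sub>0 'k) set)"
      by (simp add: ideals_set_def)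
    then show ?case
      by (simp add: mon_ideal_prod)
  qed
qed

text \<open>The coefficient of a product simplifies when a single pair of terms contributes to it. Both
  the primality of the ideals \<open>(x)\<close>, \<open>(y)\<close> and the lower bound for the number of generators are
  read off from such coefficients.\<close>

lemma lookup_mult_unique:
  fixes f g :: "'e::comm_monoid_add \<Rightarrow>\<^sub>0 'k::comm_ring_1"
  assumes "\<And>l r. l \<in> Poly_Mapping.keys f \<Longrightarrow> r \<in> Poly_Mapping.keys g \<Longrightarrow> l + r = p + q
             \<Longrightarrow> l = p \<and> r = q"
  shows "Poly_Mapping.lookup (f * g) (p + q) = Poly_Mapping.lookup f p * Poly_Mapping.lookup g q"
proof -
  let ?F = "Poly_Mapping.keys f" and ?G = "Poly_Mapping.keys g"
  have "f * g = (\<Sum>l\<in>?F. \<Sum>r\<in>?G. Poly_Mapping.single l (Poly_Mapping.lookup f l) *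
                                       Poly_Mapping.single r (Poly_Mapping.lookup g r))"
    unfolding sum_product[symmetric] sum_single_lookup ..
  then have "Poly_Mapping.lookup (f * g) (p + q) =
      (\<Sum>l\<in>?F. \<Sum>r\<in>?G. Poly_Mapping.lookup f l * Poly_Mapping.lookup g r when l + r = p + q)"
    by (simp add: lookup_sum mult_single lookup_single)
  also have "\<dots> = (\<Sum>l\<in>?F. \<Sum>r\<in>?G.
      if r = q then if l = p then Poly_Mapping.lookup f p * Poly_Mapping.lookup g q else 0 else 0)"
  proof (intro sum.cong refl)
    fix l r assume "l \<in> ?F" "r \<in> ?G"
    then show "(Poly_Mapping.lookup f l * Poly_Mapping.lookup g r when l + r = p + q) =
      (if r = q then if l = p then Poly_Mapping.lookup f p * Poly_Mapping.lookup g q else 0 else 0)"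
      using assms[of l r] by (cases "l + r = p + q") auto
  qed
  also have "\<dots> = Poly_Mapping.lookup f p * Poly_Mapping.lookup g q"
    by (cases "Poly_Mapping.lookup g q = 0") (auto simp: sum.delta in_keys_iff)
  finally show ?thesis .
qed
section \<open>Counting minimal generators\<close>

definition antichain_exps :: "(nat \<times> nat) set \<Rightarrow> bool" where
  "antichain_exps E \<longleftrightarrow> (\<forall>e\<in>E. \<forall>f\<in>E. \<forall>s. e = f + s \<longrightarrow> s = 0)"

text \<open>The lower bound holds for all generating sets, so it needs linear algebra. Keep from each
  polynomial only the terms with exponent in \<open>E\<close>. On the ideal, multiplication by \<open>h\<close> then becomes
  multiplication by the constant term of \<open>h\<close>: a term of \<open>h f\<close> with exponent in \<open>E\<close> cannot
  be a proper multiple of a term of \<open>f\<close>, because \<open>E\<close> is an antichain. So the truncations of the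
  elements of a generating set span, as a vector space, the truncations of the whole ideal, among
  which are the linearly independent monomials with exponent in \<open>E\<close>.\<close>

lemma min_num_gens_mon_ideal:
  assumes fin: "finite E" and anti: "antichain_exps E"
  shows "min_num_gens Kxy (mon_ideal E :: 'k::field poly2 set) = card E"
  unfolding min_num_gens_def
proof (rule Least_equality)
  let ?mon = "\<lambda>p. Poly_Mapping.single p (1::'k)"
  have inj: "inj_on ?mon E"
    by (rule inj_onI) (metis keys_single singleton_inject zero_neq_one)
  show "\<exists>S \<subseteq> carrier Kxy. finite S \<and> card S = card E \<and> (mon_ideal E :: 'k poly2 set) = Idl\<^bsub>Kxy\<^esub> S"
    using fin inj by (intro exI[of _ "?mon ` E"]) (simp add: genideal_monomials card_image)
  fix n
  assume "\<exists>S \<subseteq> carrier Kxy. finite S \<and> card S = n \<and> (mon_ideal E :: 'k poly2 set) = Idl\<^bsub>Kxy\<^esub> S"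
  then obtain S :: "'k poly2 set" where S: "finite S" "card S = n" "mon_ideal E = Idl\<^bsub>Kxy\<^esub> S"
    by blast
  interpret R: cring "Kxy :: 'k poly2 ring" ..
  define scale :: "'k \<Rightarrow> 'k poly2 \<Rightarrow> 'k poly2" where "scale c f = Poly_Mapping.single 0 c * f" for c f
  have lookup_scale: "Poly_Mapping.lookup (scale c f) p = c * Poly_Mapping.lookup f p" for c f p
    unfolding scale_def mult_map_scale_conv_mult[symmetric]
    by (simp add: map.rep_eq when_def)
  interpret V: vector_space scale
    by unfold_locales (auto intro!: poly_mapping_eqI simp: lookup_scale lookup_add algebra_simps)
  define trunc :: "'k poly2 \<Rightarrow> 'k poly2"
    where "trunc f = (\<Sum>e\<in>E. Poly_Mapping.single e (Poly_Mapping.lookup f e))" for f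
  have lookup_trunc: "Poly_Mapping.lookup (trunc f) p = (if p \<in> E then Poly_Mapping.lookup f p else 0)" for f p
    using fin by (simp add: trunc_def lookup_sum lookup_single when_def sum.delta)
  have trunc_mult: "trunc (h * f) = scale (Poly_Mapping.lookup h 0) (trunc f)"
    if f: "f \<in> mon_ideal E" for h f
  proof (rule poly_mapping_eqI)
    fix p
    have "Poly_Mapping.lookup (h * f) (0 + p) = Poly_Mapping.lookup h 0 * Poly_Mapping.lookup f p"
      if "p \<in> E"
    proof (rule lookup_mult_unique)
      fix l r assume "r \<in> Poly_Mapping.keys f" and lr: "l + r = 0 + p"
      then obtain e s where e: "e \<in> E" "r = e + s"
        using f unfolding mon_ideal_def by (auto simp: mem_upset_iff dest!: subsetD)
      then have "p = e + (s + l)"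
        using lr by (simp add: algebra_simps)
      then have "s + l = 0"
        using anti \<open>p \<in> E\<close> e(1) unfolding antichain_exps_def by blast
      then have "l = 0"
        by (simp add: prod_eq_iff)
      then show "l = 0 \<and> r = p"
        using lr by simp
    qed
    then show "Poly_Mapping.lookup (trunc (h * f)) p =
        Poly_Mapping.lookup (scale (Poly_Mapping.lookup h 0) (trunc f)) p"
      by (simp add: lookup_trunc lookup_scale)
  qed
  have trunc_add: "trunc (f + g) = trunc f + trunc g" for f g
    by (rule poly_mapping_eqI) (simp add: lookup_trunc lookup_add)
  \<comment> \<open>The span condition cuts out an ideal; it contains \<open>S\<close>, hence everything that \<open>S\<close> generates.\<close>
  let ?W = "{f \<in> mon_ideal E. trunc f \<in> V.span (trunc ` S)}"
  have "ideal ?W Kxy"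
    using ideal_mon_ideal[of E, where 'k = 'k] V.span_add V.span_scale V.span_zero
    unfolding ideal_of_type_algebra_iff
    by (auto simp: trunc_add trunc_mult) (simp add: trunc_def)
  moreover have "S \<subseteq> ?W"
    using S(3) R.genideal_self[of S] by (auto intro: V.span_base)
  ultimately have "mon_ideal E \<subseteq> ?W"
    unfolding S(3) by (intro R.genideal_minimal) (auto simp: S(3))
  have sub: "?mon ` E \<subseteq> V.span (trunc ` S)"
  proof
    fix g assume "g \<in> ?mon ` E"
    then obtain e where e: "e \<in> E" "g = ?mon e" by blast
    then have "g \<in> mon_ideal E"
      unfolding e(2) single_in_mon_ideal_iff mem_upset_iff by (metis add.right_neutral)
    moreover have "trunc g = g"
      using e by (intro poly_mapping_eqI) (auto simp: lookup_trunc lookup_single when_def)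
    ultimately show "g \<in> V.span (trunc ` S)"
      using \<open>mon_ideal E \<subseteq> ?W\<close> by force
  qed
  have "V.independent (?mon ` E)"
  proof (rule V.independent_if_scalars_zero)
    fix c x assume 0: "(\<Sum>x\<in>?mon ` E. scale (c x) x) = 0" and "x \<in> ?mon ` E"
    then obtain e where e: "e \<in> E" "x = ?mon e" by blast
    have "0 = Poly_Mapping.lookup (\<Sum>p\<in>E. scale (c (?mon p)) (?mon p)) e"
      using 0 inj by (simp add: sum.reindex)
    also have "\<dots> = c x"
      using e fin by (simp add: lookup_sum lookup_scale lookup_single when_def sum.delta if_distrib cong: if_cong)
    finally show "c x = 0" ..
  qed (use fin in simp)
  then have "card (?mon ` E) \<le> card (trunc ` S)"
    using V.independent_span_bound sub S(1) by blast
  also have "\<dots> \<le> n"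
    using card_image_le[OF S(1)] S(2) by simp
  finally show "card E \<le> n"
    using card_image[OF inj] by simp
qed

section \<open>Height\<close>

text \<open>A chain of length 2 would have the zero ideal as its middle member, with another ideal
  strictly below it.\<close>

lemma prime_height_le_1:
  fixes P :: "'a::comm_ring_1 set"
  assumes min: "\<And>Q. primeideal Q ring_of_type_algebra \<Longrightarrow> Q \<subset> P \<Longrightarrow> Q = {0}"
  shows "prime_height ring_of_type_algebra P \<le> 1"
  unfolding prime_height_def
proof (rule Sup_least, elim CollectE exE conjE)
  fix x n and C :: "nat \<Rightarrow> 'a set"
  assume x: "x = enat n"
    and prime: "\<forall>i\<le>n. primeideal (C i) ring_of_type_algebra"
    and chain: "\<forall>i<n. C i \<subset> C (Suc i)" and P: "C n = P"
  have "n \<le> 1"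
  proof (rule ccontr)
    assume "\<not> n \<le> 1"
    define k where "k = n - 2"
    have n: "n = Suc (Suc k)"
      using \<open>\<not> n \<le> 1\<close> by (simp add: k_def)
    have "C (Suc k) = {0}"
      using prime chain P unfolding n by (intro min) (simp_all add: less_Suc_eq)
    moreover have "C k \<subset> C (Suc k)"
      using chain n by simp
    moreover have "0 \<in> C k"
      using primeideal.axioms(1)[OF prime[rule_format, of k]]
      by (simp add: n ideal_of_type_algebra_iff)
    ultimately show False by auto
  qed
  then show "x \<le> 1"
    by (simp add: x one_enat_def)
qed

text \<open>Both variables are treated at once: \<open>c\<close> is the coordinate counting the exponent of the
  variable with exponent vector \<open>u\<close>.

  Primality: if neither \<open>f\<close> nor \<open>g\<close> lies in the ideal, take in each a term of lowest degree among
  the terms free of the variable. No other pair of terms contributes to the product of these two, so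
  it survives in \<open>f g\<close>.

  Height: let \<open>Q\<close> be a prime strictly inside the ideal. It does not contain the variable, so
  dividing an element of \<open>Q\<close> by the variable stays in \<open>Q\<close>. Elements of \<open>Q\<close> are thus divisible by
  every power of the variable, and \<open>Q = 0\<close>.\<close>

lemma variable_prime_height:
  fixes c :: "nat \<times> nat \<Rightarrow> nat"
  assumes cu: "c = fst \<and> u = (1, 0) \<or> c = snd \<and> u = (0, 1)"
  shows "primeideal (mon_ideal {u} :: 'k::field poly2 set) Kxy"
    and "prime_height Kxy (mon_ideal {u} :: 'k poly2 set) \<le> 1"
proof -
  let ?P = "mon_ideal {u} :: 'k poly2 set"
  have c_add: "c (p + q) = c p + c q" and c_u: "c u = 1" for p q
    using cu by auto
  have mem: "p \<in> {u} + UNIV \<longleftrightarrow> c p \<noteq> 0" for p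
  proof
    assume "c p \<noteq> 0"
    then have "p = u + (p - u)"
      using cu by (auto simp: prod_eq_iff)
    then show "p \<in> {u} + UNIV"
      unfolding mem_upset_iff by blast
  qed (auto simp: mem_upset_iff c_add c_u)
  have low: "\<exists>p\<in>Poly_Mapping.keys f. c p = 0 \<and>
        (\<forall>l\<in>Poly_Mapping.keys f. c l = 0 \<longrightarrow> fst p + snd p \<le> fst l + snd l)"
    if f: "f \<notin> ?P" for f
  proof -
    obtain p0 where "p0 \<in> Poly_Mapping.keys f \<and> c p0 = 0"
      using f mem unfolding mon_ideal_def by blast
    from ex_has_least_nat[of "\<lambda>p. p \<in> Poly_Mapping.keys f \<and> c p = 0", OF this, of "\<lambda>p. fst p + snd p"]
    show ?thesis by blast
  qed
  have prime: "f \<in> ?P \<or> g \<in> ?P" if fg: "f * g \<in> ?P" for f g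
  proof (rule ccontr)
    assume "\<not> ?thesis"
    then obtain p q where
      p: "p \<in> Poly_Mapping.keys f" "c p = 0"
        "\<And>l. l \<in> Poly_Mapping.keys f \<Longrightarrow> c l = 0 \<Longrightarrow> fst p + snd p \<le> fst l + snd l" and
      q: "q \<in> Poly_Mapping.keys g" "c q = 0"
        "\<And>l. l \<in> Poly_Mapping.keys g \<Longrightarrow> c l = 0 \<Longrightarrow> fst q + snd q \<le> fst l + snd l"
      using low[of f] low[of g] by blast
    have "Poly_Mapping.lookup (f * g) (p + q) = Poly_Mapping.lookup f p * Poly_Mapping.lookup g q"
    proof (rule lookup_mult_unique)
      fix l r
      assume l: "l \<in> Poly_Mapping.keys f" and r: "r \<in> Poly_Mapping.keys g" and lr: "l + r = p + q"
      have "c l + c r = 0"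
        using arg_cong[OF lr, of c] p(2) q(2) by (simp add: c_add)
      then have cs: "c l = 0" "c r = 0" by auto
      have "fst l + fst r = fst p + fst q" "snd l + snd r = snd p + snd q"
        using arg_cong[OF lr, of fst] arg_cong[OF lr, of snd] by auto
      then have "fst p + snd p = fst l + snd l" "fst q + snd q = fst r + snd r"
        using p(3)[OF l cs(1)] q(3)[OF r cs(2)] by linarith+
      then show "l = p \<and> r = q"
        using cu cs p(2) q(2) by (auto simp: prod_eq_iff)
    qed
    then have "p + q \<in> Poly_Mapping.keys (f * g)"
      using p(1) q(1) by (simp add: in_keys_iff)
    then have "c (p + q) \<noteq> 0"
      using fg mem unfolding mon_ideal_def by blast
    then show False
      using p(2) q(2) by (simp add: c_add)
  qed
  have "1 \<notin> ?P"
    using mem[of 0] cu by (auto simp: mon_ideal_def)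
  then show "primeideal ?P Kxy"
    using ideal_mon_ideal prime
    by (intro primeidealI) auto
  show "prime_height Kxy ?P \<le> 1"
  proof (rule prime_height_le_1)
    fix Q :: "'k poly2 set" assume Q: "primeideal Q Kxy" "Q \<subset> ?P"
    let ?v = "Poly_Mapping.single u (1::'k)"
    have Q_ideal: "ideal Q Kxy"
      using Q(1) by (rule primeideal.axioms(1))
    have P_eq: "?P = Idl\<^bsub>Kxy\<^esub> {?v}"
      using genideal_monomials[of "{u}", where 'k = 'k] by simp
    have "?v \<notin> Q"
      using Q(2) P_eq Q_ideal ring.genideal_minimal[of Kxy Q "{?v}"] cring_from_type_algebra cring.axioms(1)
      by (metis empty_subsetI insert_subset psubset_imp_subset psubsetE)
    have div: "\<exists>g\<in>Q. f = ?v * g" if "f \<in> Q" for f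
    proof -
      interpret cring "Kxy :: 'k poly2 ring" ..
      have "f \<in> PIdl\<^bsub>Kxy\<^esub> ?v"
        using that Q(2) P_eq cgenideal_eq_genideal[of ?v] by auto
      then obtain g where g: "f = ?v * g"
        by (auto simp: cgenideal_def mult.commute)
      then have "g \<in> Q"
        using primeideal.I_prime[OF Q(1), of ?v g] that \<open>?v \<notin> Q\<close> by simp
      then show ?thesis using g by blast
    qed
    have high: "\<forall>f\<in>Q. \<forall>p\<in>Poly_Mapping.keys f. n \<le> c p" for n
    proof (induction n)
      case (Suc n)
      show ?case
      proof safe
        fix f p assume "f \<in> Q" "p \<in> Poly_Mapping.keys f"
        then obtain g where g: "g \<in> Q" "f = ?v * g"
          using div by blast
        then obtain r where "r \<in> Poly_Mapping.keys g" "p = u + r"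
          using keys_mult[of ?v g] \<open>p \<in> Poly_Mapping.keys f\<close> by auto
        then show "Suc n \<le> c p"
          using Suc g(1) by (simp add: c_add c_u)
      qed
    qed simp
    have "f = 0" if "f \<in> Q" for f
      using high[rule_format, OF that] by (metis Suc_n_not_le_n keys_eq_empty ex_in_conv)
    moreover have "0 \<in> Q"
      using Q_ideal by (simp add: ideal_of_type_algebra_iff)
    ultimately show "Q = {0}" by blast
  qed
qed

section \<open>Sumsets\<close>

text \<open>The translates \<open>B + Min C\<close> and \<open>Max B + C\<close> lie in the sumset. Everything in the first is at
  most \<open>Max B + Min C\<close> and everything in the second is at least that, so they share at most this one
  element.\<close>

lemma card_sumset_ge:
  fixes B C :: "'a::linordered_cancel_ab_semigroup_add set"
  assumes "finite B" and "finite C" and "B \<noteq> {}" and "C \<noteq> {}"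
  shows "card B + card C \<le> card (B + C) + 1"
proof -
  let ?U = "(\<lambda>x. x + Min C) ` B" and ?V = "(\<lambda>y. Max B + y) ` C"
  have "?U \<inter> ?V \<subseteq> {Max B + Min C}"
  proof
    fix z assume "z \<in> ?U \<inter> ?V"
    then obtain x y where "x \<in> B" "y \<in> C" and z: "z = x + Min C" "z = Max B + y"
      by blast
    have "x + Min C \<le> Max B + Min C" "Max B + Min C \<le> Max B + y"
      using assms \<open>x \<in> B\<close> \<open>y \<in> C\<close> by (simp_all add: add_left_mono add_right_mono)
    then show "z \<in> {Max B + Min C}"
      using z by (metis order_antisym singletonI)
  qed
  then have "card (?U \<inter> ?V) \<le> 1"
    using card_mono[of "{Max B + Min C}"] by simp
  moreover have "card ?U = card B" "card ?V = card C"
    by (auto intro!: card_image inj_onI)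
  moreover have "card ?U + card ?V = card (?U \<union> ?V) + card (?U \<inter> ?V)"
    using assms by (intro card_Un_Int) auto
  moreover have "card (?U \<union> ?V) \<le> card (B + C)"
  proof (intro card_mono finite_set_plus assms)
    show "?U \<union> ?V \<subseteq> B + C"
      using Max_in[OF assms(1,3)] Min_in[OF assms(2,4)] by blast
  qed
  ultimately show ?thesis by linarith
qed

lemma finite_iterated_sumset:
  "finite A \<Longrightarrow> finite (\<Sum>i<(k::nat). A)" for A :: "'a::comm_monoid_add set"
  by (induction k) (auto intro: finite_set_plus)

lemma iterated_sumset_nonempty:
  "A \<noteq> {} \<Longrightarrow> (\<Sum>i<(k::nat). A) \<noteq> {}" for A :: "'a::comm_monoid_add set"
  by (induction k) (auto simp: set_plus_def)

lemma card_iterated_sumset_ge: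
  fixes A :: "nat set"
  assumes "finite A" "A \<noteq> {}" "k \<ge> 2"
  shows "card (A + A) + (k - 2) * (card A - 1) \<le> card (\<Sum>i<k. A)"
  using \<open>k \<ge> 2\<close>
proof (induction k rule: nat_induct_at_least)
  case base
  then show ?case by (simp add: numeral_2_eq_2)
next
  case (Suc k)
  have "card (\<Sum>i<k. A) + card A \<le> card (\<Sum>i<Suc k. A) + 1"
    using card_sumset_ge[OF finite_iterated_sumset[OF assms(1)] assms(1)
        iterated_sumset_nonempty[OF assms(2)] assms(2), of k] by simp
  moreover have "Suc k - 2 = Suc (k - 2)"
    using Suc.hyps by simp
  moreover have "card A > 0"
    using assms by (simp add: card_gt_0_iff)
  ultimately show ?case
    using Suc.IH by simp
qed

text \<open>The sumset is \<open>A \<union> (d + A)\<close>, and the two parts meet exactly in \<open>d\<close>.\<close>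

lemma card_sumset_endpoints:
  fixes A :: "nat set"
  assumes A: "A \<subseteq> {..d}" "0 \<in> A" "d \<in> A"
  shows "card ({0, d} + A) + 1 = 2 * card A"
proof -
  have fin: "finite A"
    using A(1) finite_subset by blast
  have "{0, d} + A = A \<union> (\<lambda>a. d + a) ` A"
    by (auto simp: set_plus_def)
  moreover have "A \<inter> (\<lambda>a. d + a) ` A = {d}"
    using A by (force simp: image_iff)
  moreover have "card ((\<lambda>a. d + a) ` A) = card A"
    by (intro card_image) simp
  ultimately show ?thesis
    using card_Un_Int[of A "(\<lambda>a. d + a) ` A"] fin by simp
qed

text \<open>For the forward direction, \<open>card_iterated_sumset_ge\<close> bounds the cardinality of \<open>A + A\<close> by
  that of its subset \<open>{0, d} + A\<close>; the converse is the case \<open>k = 2\<close>.\<close>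

lemma card_iterated_sumset_eq_iff:
  fixes A :: "nat set"
  assumes A: "A \<subseteq> {..d}" "0 \<in> A" "d \<in> A"
  shows "(\<exists>k\<ge>2. int (card (\<Sum>i<k. A)) = int k * (int (card A) - 1) + 1) \<longleftrightarrow> A + A = {0, d} + A"
proof
  have fin: "finite A"
    using A(1) finite_subset by blast
  have pos: "card A \<ge> 1"
    using fin A(2) by (simp add: Suc_le_eq card_gt_0_iff) blast
  note ends = card_sumset_endpoints[OF A]
  {
    assume "\<exists>k\<ge>2. int (card (\<Sum>i<k. A)) = int k * (int (card A) - 1) + 1"
    then obtain k where k: "k \<ge> 2"
      and "int (card (\<Sum>i<k. A)) = int k * (int (card A) - 1) + 1" by blast
    then have "int (card (\<Sum>i<k. A)) = int (k * (card A - 1) + 1)"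
      using pos by (simp add: of_nat_diff)
    then have "card (\<Sum>i<k. A) = k * (card A - 1) + 1"
      by (simp only: of_nat_eq_iff)
    moreover have "k * (card A - 1) = 2 * (card A - 1) + (k - 2) * (card A - 1)"
      using k by (metis le_add_diff_inverse distrib_right)
    ultimately have "card (A + A) \<le> card ({0, d} + A)"
      using card_iterated_sumset_ge[OF fin _ k] A(2) ends pos by fastforce
    moreover have "{0, d} + A \<subseteq> A + A"
      using A by (intro set_plus_mono2) auto
    ultimately show "A + A = {0, d} + A"
      using fin by (metis card_seteq finite_set_plus)
  next
    assume eq: "A + A = {0, d} + A"
    have "(\<Sum>i<2::nat. A) = A + A"
      by (simp add: numeral_2_eq_2)
    then show "\<exists>k\<ge>2. int (card (\<Sum>i<k. A)) = int k * (int (card A) - 1) + 1"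
      using eq ends by (intro exI[of _ 2]) simp
  }
qed

section \<open>Ideals generated in a single degree\<close>

definition exps_of_degree :: "nat \<Rightarrow> nat set \<Rightarrow> (nat \<times> nat) set" where
  "exps_of_degree n A = (\<lambda>a. (a, n - a)) ` A"

lemma exps_of_degree_iff: "p \<in> exps_of_degree n A \<longleftrightarrow> fst p \<in> A \<and> snd p = n - fst p"
  by (cases p) (auto simp: exps_of_degree_def)

lemma card_exps_of_degree: "card (exps_of_degree n A) = card A"
  unfolding exps_of_degree_def by (intro card_image inj_onI) simp

lemma antichain_exps_of_degree:
  assumes "A \<subseteq> {..n}"
  shows "antichain_exps (exps_of_degree n A)"
proof -
  have "s = 0" if "e \<in> exps_of_degree n A" "f \<in> exps_of_degree n A" "e = f + s" for e f s
  proof -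
    have "fst e + snd e = n" "fst f + snd f = n"
      using that(1,2) assms by (auto simp: exps_of_degree_def)
    then show ?thesis
      using that(3) by (simp add: prod_eq_iff)
  qed
  then show ?thesis
    unfolding antichain_exps_def by blast
qed

lemma exps_of_degree_plus:
  assumes "A \<subseteq> {..n}" "B \<subseteq> {..k}"
  shows "exps_of_degree n A + exps_of_degree k B = exps_of_degree (n + k) (A + B)"
proof -
  have *: "(a, n - a) + (b, k - b) = (a + b, n + k - (a + b))" if "a \<in> A" "b \<in> B" for a b
  proof -
    have "a \<le> n" "b \<le> k"
      using that assms by auto
    then show ?thesis by simp
  qed
  show ?thesis
  proof (intro Set.set_eqI iffI)
    fix p assume "p \<in> exps_of_degree n A + exps_of_degree k B"
    then obtain a b where "a \<in> A" "b \<in> B" "p = (a, n - a) + (b, k - b)"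
      unfolding set_plus_def exps_of_degree_def by blast
    then show "p \<in> exps_of_degree (n + k) (A + B)"
      using *[of a b] unfolding exps_of_degree_def by (auto simp del: plus_prod_def)
  next
    fix p assume "p \<in> exps_of_degree (n + k) (A + B)"
    then obtain a b where ab: "a \<in> A" "b \<in> B" "p = (a + b, n + k - (a + b))"
      unfolding set_plus_def exps_of_degree_def by blast
    then have "p = (a, n - a) + (b, k - b)"
      using * by simp
    then show "p \<in> exps_of_degree n A + exps_of_degree k B"
      using ab unfolding set_plus_def exps_of_degree_def by blast
  qed
qed

lemma sumset_atMost:
  fixes A B :: "nat set"
  assumes "A \<subseteq> {..n}" "B \<subseteq> {..k}"
  shows "A + B \<subseteq> {..n + k}"
  using assms by (fastforce simp: set_plus_def)

lemma iterated_sumset_exps_of_degree: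
  assumes "A \<subseteq> {..n}"
  shows "(\<Sum>i<k. A) \<subseteq> {..k * n}"
    and "(\<Sum>i<k. exps_of_degree n A) = exps_of_degree (k * n) (\<Sum>i<k. A)"
proof (induction k)
  case 0
  {
    case 1 show ?case by simp
  next
    case 2 show ?case by (simp add: exps_of_degree_def zero_prod_def)
  }
next
  case (Suc k)
  {
    case 1
    show ?case
      using sumset_atMost[OF Suc(1) assms] by (simp add: add.commute)
  next
    case 2
    show ?case
      using exps_of_degree_plus[OF Suc(1) assms] Suc(2) by (simp add: add.commute)
  }
qed

lemma mon_ideal_exps_of_degree_inject:
  assumes "A \<subseteq> {..n}" "B \<subseteq> {..n}"
    and eq: "mon_ideal (exps_of_degree n A) = (mon_ideal (exps_of_degree n B) :: 'k::field poly2 set)"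
  shows "A = B"
proof -
  have mem: "Poly_Mapping.single (a, n - a) (1::'k) \<in> mon_ideal (exps_of_degree n C) \<longleftrightarrow> a \<in> C"
    if C: "C \<subseteq> {..n}" and a: "a \<le> n" for a C
  proof
    assume "Poly_Mapping.single (a, n - a) (1::'k) \<in> mon_ideal (exps_of_degree n C)"
    then obtain e s where e: "e \<in> exps_of_degree n C" and "(a, n - a) = e + s"
      unfolding single_in_mon_ideal_iff mem_upset_iff by blast
    then have "a = fst e + fst s" "n - a = snd e + snd s"
      by (auto simp only: prod_eq_iff fst_conv snd_conv fst_add snd_add)
    moreover have "fst e \<in> C" "fst e + snd e = n"
      using e C by (auto simp: exps_of_degree_def)
    ultimately have "a = fst e"
      using a by linarith
    then show "a \<in> C" using \<open>fst e \<in> C\<close> by simp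
  next
    assume "a \<in> C"
    then have "(a, n - a) \<in> exps_of_degree n C"
      by (simp add: exps_of_degree_iff)
    then show "Poly_Mapping.single (a, n - a) (1::'k) \<in> mon_ideal (exps_of_degree n C)"
      unfolding single_in_mon_ideal_iff mem_upset_iff by (metis add.right_neutral)
  qed
  have "a \<in> A \<longleftrightarrow> a \<in> B" if "a \<le> n" for a
    using mem[OF assms(1) that] mem[OF assms(2) that] eq by simp
  then show ?thesis
    using assms(1,2) by auto
qed

lemma xy_monomial_dvd_iff:
  "(xy_monomial a b :: 'k::field poly2) dvd xy_monomial c d \<longleftrightarrow> a \<le> c \<and> b \<le> d"
proof
  assume "(xy_monomial a b :: 'k poly2) dvd xy_monomial c d"
  then obtain g where "(xy_monomial c d :: 'k poly2) = xy_monomial a b * g"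
    by (rule dvdE)
  then have "(c, d) \<in> Poly_Mapping.keys (xy_monomial a b * g :: 'k poly2)"
    by (metis keys_single singletonI xy_monomial_def zero_neq_one)
  then show "a \<le> c \<and> b \<le> d"
    using keys_mult[of "xy_monomial a b" g] by (auto simp: xy_monomial_def)
next
  assume "a \<le> c \<and> b \<le> d"
  then have "(xy_monomial c d :: 'k poly2) = xy_monomial a b * xy_monomial (c - a) (d - b)"
    by (simp add: xy_monomial_def mult_single)
  then show "(xy_monomial a b :: 'k poly2) dvd xy_monomial c d" by simp
qed

text \<open>Among the monomials of the ideal that divide a given one, a monomial of least total degree is
  a minimal generator. So the minimal generators have the same
  multiples as any other set of monomial generators.\<close>

lemma mon_ideal_minimal_generators:
  fixes I :: "'k::field poly2 set"
  assumes "monomial_ideal I"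
  shows "I = mon_ideal {(a, b). xy_monomial a b \<in> min_monomial_gens I}" (is "I = mon_ideal ?G")
proof -
  obtain M :: "'k poly2 set" where M: "M \<subseteq> monomials" "I = Idl\<^bsub>Kxy\<^esub> M"
    using assms unfolding monomial_ideal_def by blast
  define E where "E = {p. Poly_Mapping.single p (1::'k) \<in> M}"
  have "M = (\<lambda>p. Poly_Mapping.single p 1) ` E"
    using M(1) unfolding E_def monomials_def xy_monomial_def by blast
  then have I: "I = mon_ideal E"
    using M(2) genideal_monomials by simp
  have mem: "xy_monomial a b \<in> I \<longleftrightarrow> (a, b) \<in> E + UNIV" for a b
    unfolding I xy_monomial_def by (rule single_in_mon_ideal_iff)
  have below: "\<exists>a' b'. xy_monomial a' b' \<in> min_monomial_gens I \<and> a' \<le> a \<and> b' \<le> b"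
    if ab: "xy_monomial a b \<in> I" for a b
  proof -
    have "\<exists>p. ((xy_monomial (fst p) (snd p) \<in> I \<and> fst p \<le> a \<and> snd p \<le> b) \<and>
        (\<forall>q. xy_monomial (fst q) (snd q) \<in> I \<and> fst q \<le> a \<and> snd q \<le> b \<longrightarrow>
             fst p + snd p \<le> fst q + snd q))"
      using ab by (intro ex_has_least_nat[of _ "(a, b)"]) simp
    then obtain a' b' where p: "xy_monomial a' b' \<in> I" "a' \<le> a" "b' \<le> b"
      and least: "\<And>a'' b''. xy_monomial a'' b'' \<in> I \<Longrightarrow> a'' \<le> a \<Longrightarrow> b'' \<le> b
         \<Longrightarrow> a' + b' \<le> a'' + b''"
      by fastforce
    have "xy_monomial a' b' \<in> min_monomial_gens I"
      unfolding min_monomial_gens_def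
    proof (intro CollectI conjI ballI impI)
      show "xy_monomial a' b' \<in> monomials \<inter> I"
        using p(1) by (auto simp: monomials_def)
      fix v assume v: "v \<in> monomials \<inter> I" "v dvd xy_monomial a' b'"
      then obtain a'' b'' where v': "v = xy_monomial a'' b''"
        by (auto simp: monomials_def)
      have "a'' \<le> a'" "b'' \<le> b'"
        using v(2) unfolding v' xy_monomial_dvd_iff by auto
      moreover from this have "a' + b' \<le> a'' + b''"
        using v(1) v' p by (intro least) auto
      ultimately have "a'' = a'" "b'' = b'"
        by linarith+
      then show "v = xy_monomial a' b'"
        using v' by simp
    qed
    then show ?thesis using p by blast
  qed
  have "E + UNIV = ?G + UNIV"
  proof (intro Set.set_eqI iffI)
    fix p :: "nat \<times> nat"
    obtain a b where p: "p = (a, b)" by (cases p)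
    {
      assume "p \<in> E + UNIV"
      then obtain a' b' where "(a', b') \<in> ?G" "a' \<le> a" "b' \<le> b"
        using below[of a b] mem p by auto
      moreover from this have "p = (a', b') + (a - a', b - b')"
        using p by simp
      ultimately show "p \<in> ?G + UNIV"
        unfolding mem_upset_iff by blast
    next
      assume "p \<in> ?G + UNIV"
      then obtain a' b' s where "(a', b') \<in> ?G" and ps: "p = (a', b') + s"
        unfolding mem_upset_iff by blast
      then have "(a', b') \<in> E + UNIV"
        using mem by (auto simp: min_monomial_gens_def)
      then obtain e t where "e \<in> E" "(a', b') = e + t"
        unfolding mem_upset_iff by blast
      then show "p \<in> E + UNIV"
        unfolding mem_upset_iff ps by (metis add.assoc)
    }
  qed
  then show ?thesis
    unfolding I by (simp only: mon_ideal_def)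
qed

lemma equigenerated_eq_mon_ideal:
  fixes I :: "'k::field poly2 set"
  assumes "monomial_ideal I" "generated_in_degree I d"
  obtains A where "A \<subseteq> {..d}" "I = mon_ideal (exps_of_degree d A)"
proof
  let ?A = "{a. a \<le> d \<and> xy_monomial a (d - a) \<in> min_monomial_gens I}"
  have "{(a, b). xy_monomial a b \<in> min_monomial_gens I} = exps_of_degree d ?A"
    using assms(2) unfolding generated_in_degree_def
    by (fastforce simp: exps_of_degree_iff)
  then show "I = mon_ideal (exps_of_degree d ?A)"
    using mon_ideal_minimal_generators[OF assms(1)] by simp
qed auto

text \<open>If one of the two variables occurred in every generator, the ideal would lie in the prime
  generated by that variable, whose height is at most 1. A generator of degree \<open>d\<close> free of one
  variable is the \<open>d\<close>-th power of the other.\<close>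

lemma pure_powers_if_height_2:
  assumes A: "A \<subseteq> {..d}"
    and height: "ideal_height Kxy (mon_ideal (exps_of_degree d A) :: 'k::field poly2 set) = 2"
  shows "0 \<in> A" "d \<in> A"
proof -
  have ex: "\<exists>a\<in>A. c (a, d - a) = 0"
    if cu: "c = fst \<and> u = (1, 0) \<or> c = snd \<and> u = (0, 1)" for c :: "nat \<times> nat \<Rightarrow> nat" and u :: "nat \<times> nat"
  proof (rule ccontr)
    assume none: "\<not> ?thesis"
    have "e \<in> {u} + UNIV" if "e \<in> exps_of_degree d A" for e
    proof -
      have "c e \<noteq> 0"
        using none that by (auto simp: exps_of_degree_def)
      then have "e = u + (e - u)"
        using cu by (auto simp: prod_eq_iff)
      then show ?thesis
        unfolding mem_upset_iff by blast
    qed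
    then have "exps_of_degree d A + UNIV \<subseteq> {u} + UNIV"
      unfolding mem_upset_iff subset_iff by (metis add.assoc)
    then have "mon_ideal (exps_of_degree d A) \<subseteq> (mon_ideal {u} :: 'k poly2 set)"
      unfolding mon_ideal_def by blast
    then have "ideal_height Kxy (mon_ideal (exps_of_degree d A) :: 'k poly2 set)
        \<le> prime_height Kxy (mon_ideal {u} :: 'k poly2 set)"
      unfolding ideal_height_def using variable_prime_height(1)[OF cu]
      by (intro Inf_lower) blast
    also have "\<dots> \<le> 1"
      by (rule variable_prime_height(2)[OF cu])
    finally show False
      unfolding height by simp
  qed
  show "0 \<in> A" "d \<in> A"
    using ex[of fst "(1, 0)"] ex[of snd "(0, 1)"] A by (auto simp: le_antisym subset_iff)
qed

theorem corollary3p5: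
  fixes I J :: "'k::field poly2 set" and d m :: nat
  assumes "monomial_ideal I"
    and "generated_in_degree I d"
    and "min_num_gens Kxy I = m"
    and "ideal_height Kxy I = 2"
    and "J = Idl\<^bsub>Kxy\<^esub> {var_x ^ d, var_y ^ d}"
  shows "(\<exists>k\<ge>2. int (min_num_gens Kxy (I [^]\<^bsub>ideals_set Kxy\<^esub> k)) = int k * (int m - 1) + 1)
     \<longleftrightarrow> I [^]\<^bsub>ideals_set Kxy\<^esub> (2::nat) = J \<cdot>\<^bsub>Kxy\<^esub> I"
proof -
  obtain A where A: "A \<subseteq> {..d}" and I: "I = mon_ideal (exps_of_degree d A)"
    using equigenerated_eq_mon_ideal[OF assms(1,2)] .
  have ends: "0 \<in> A" "d \<in> A"
    using pure_powers_if_height_2[OF A] assms(4) unfolding I by auto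
  have gens: "min_num_gens Kxy (mon_ideal (exps_of_degree n B) :: 'k poly2 set) = card B"
    if "B \<subseteq> {..n}" for n B
    using min_num_gens_mon_ideal[OF _ antichain_exps_of_degree[OF that]] finite_subset[OF that]
    by (simp add: card_exps_of_degree) (simp add: exps_of_degree_def)
  have m: "m = card A"
    using assms(3) gens[OF A] unfolding I by simp
  have pow: "I [^]\<^bsub>ideals_set Kxy\<^esub> k = mon_ideal (exps_of_degree (k * d) (\<Sum>i<k. A))" for k :: nat
    unfolding I mon_ideal_pow iterated_sumset_exps_of_degree(2)[OF A] ..
  have "xy_monomial 0 d = (var_y ^ d :: 'k poly2)" "xy_monomial d 0 = (var_x ^ d :: 'k poly2)"
    by (simp_all add: xy_monomial_eq)
  then have "{var_x ^ d, var_y ^ d :: 'k poly2} =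
      (\<lambda>p. Poly_Mapping.single p 1) ` exps_of_degree d {0, d}"
    by (simp add: exps_of_degree_def xy_monomial_def insert_commute)
  then have "J = mon_ideal (exps_of_degree d {0, d})"
    using assms(5) genideal_monomials by simp
  then have JI: "J \<cdot>\<^bsub>Kxy\<^esub> I = mon_ideal (exps_of_degree (2 * d) ({0, d} + A))"
    using A by (simp add: I mon_ideal_prod exps_of_degree_plus mult_2)
  have sub: "A + A \<subseteq> {..2 * d}" "{0, d} + A \<subseteq> {..2 * d}"
    using sumset_atMost[of _ d A d] A by (auto simp: mult_2)
  have "I [^]\<^bsub>ideals_set Kxy\<^esub> (2::nat) = J \<cdot>\<^bsub>Kxy\<^esub> I \<longleftrightarrow> A + A = {0, d} + A"
    unfolding JI pow using mon_ideal_exps_of_degree_inject[OF sub]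
    by (auto simp: numeral_2_eq_2)
  moreover have "min_num_gens Kxy (I [^]\<^bsub>ideals_set Kxy\<^esub> k) = card (\<Sum>i<k. A)" for k :: nat
    unfolding pow by (rule gens[OF iterated_sumset_exps_of_degree(1)[OF A]])
  ultimately show ?thesis
    using card_iterated_sumset_eq_iff[OF A ends] by (simp add: m)
qed

end
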